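(* Let $n\ge4$ and $d\ge1$ be integers, and let $u_1,\dots,u_n\in(2\mathbb{Z}_{\ge 0})^n$ be points each of whose coordinate sums equals $2d$, such that $\mathcal U=\mathrm{conv}\{u_1,\dots,u_n\}$ is an $(n-1)$-dimensional simplex. Then $(n-2)\mathcal U\cap\mathbb{Z}^n$ is $((n-2)\mathcal U)$-mediated.
   Context: For a simplex $\mathcal V=\mathrm{conv}\{v_1,\dots,v_n\}$ with vertices $v_i\in(2\mathbb{Z})^n$, a set $S\subseteq \mathcal V\cap\mathbb{Z}^n$ containing all vertices $v_i$ is called $\mathcal V$-mediated if every $y\in S$ either equals some vertex $v_i$, or there exist $z_1\neq z_2$ in $S\cap(2\mathbb{Z})^n$ with $y=\tfrac12(z_1+z_2)$. Here $(n-2)\mathcal U$ is the simplex with vertices $(n-2)u_1,\dots,(n-2)u_n$. *)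

theory Defs
  imports "HOL-Analysis.Analysis"
begin

definition int_lattice :: "(real ^ 'n) set" where
  "int_lattice = {x. \<forall>j. x $ j \<in> \<int>}"

definition even_lattice :: "(real ^ 'n) set" where
  "even_lattice = {x. \<forall>j. \<exists>k::int. x $ j = 2 * real_of_int k}"

text \<open>The index type \<open>'n\<close> serves both for the coordinates and for the vertices, so that a
  family \<open>v\<close> lists exactly \<open>n = CARD('n)\<close> points of \<open>n\<close>-dimensional space. The simplex
  is given by its family of vertices \<open>v\<close>; it is the convex hull of \<open>range v\<close>. The notion
  is meant for affinely independent \<open>v\<close> with values in \<^const>\<open>even_lattice\<close>.\<close>

definition mediated :: "('n \<Rightarrow> real ^ 'n) \<Rightarrow> (real ^ 'n) set \<Rightarrow> bool" where
  "mediated v S \<longleftrightarrow>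
     S \<subseteq> convex hull (range v) \<inter> int_lattice \<and>
     range v \<subseteq> S \<and>
     (\<forall>y\<in>S. (\<exists>i. y = v i) \<or>
        (\<exists>z1 \<in> S \<inter> even_lattice. \<exists>z2 \<in> S \<inter> even_lattice.
           z1 \<noteq> z2 \<and> y = (1/2) *\<^sub>R (z1 + z2)))"

end

theory Submission
  imports Defs
begin

text \<open>Write \<open>y = \<Sum>\<^sub>i l\<^sub>i u\<^sub>i\<close> with \<open>l\<^sub>i \<ge> 0\<close> and \<open>\<Sum>\<^sub>i l\<^sub>i = k = n - 2\<close>. It suffices to find weights
  \<open>0 \<le> \<mu>\<^sub>i \<le> 2 l\<^sub>i\<close> of total \<open>k\<close>, different from \<open>l\<close>, with \<open>z\<^sub>1 = \<Sum>\<^sub>i \<mu>\<^sub>i u\<^sub>i\<close> even: then \<open>z\<^sub>2 = 2 y - z\<^sub>1\<close>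
  is even and lies in the simplex as well. Since \<open>2 y\<close> and the \<open>u\<^sub>i\<close> are even, \<open>z\<^sub>1\<close> is even as soon
  as \<open>\<mu>\<close> is an integer multiple of \<open>2 l\<close> plus an integer vector.

  Let \<open>a\<^sub>i = \<lfloor>2 l\<^sub>i\<rfloor>\<close>. If \<open>\<Sum>\<^sub>i a\<^sub>i \<ge> k\<close>, an integral \<open>\<mu>\<close> exists. Otherwise \<open>\<Sum>\<^sub>i a\<^sub>i = k - 1\<close>, and
  \<open>g\<^sub>i = a\<^sub>i + 1 - 2 l\<^sub>i\<close> are positive numbers of sum \<open>1\<close>. Single out an index \<open>p\<close>, and let \<open>T(j)\<close> be
  the sum over \<open>i \<noteq> p\<close> of the fractional parts \<open>t\<^sub>i(j) \<in> (0, 1]\<close> of \<open>j g\<^sub>i\<close>. Then \<open>T(1) = 1 - g\<^sub>p < 1\<close>,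
  whereas \<open>T(N) = n - 1\<close> for a common denominator \<open>N\<close> of the \<open>g\<^sub>i\<close>, which exists by Cramer's rule.
  At the last \<open>j\<close> before \<open>T\<close> first reaches \<open>1\<close>, no fractional part wraps around, so that the weights
  \<open>a\<^sub>i + t\<^sub>i(j)\<close> for \<open>i \<noteq> p\<close> and \<open>a\<^sub>p + 1 - T(j)\<close> for \<open>p\<close> are as required.\<close>

section \<open>Fractional parts of multiples\<close>

text \<open>The fractional part normalised to the half-open interval \<open>(0, 1]\<close>.\<close>

definition upper_frac :: "real \<Rightarrow> real" where
  "upper_frac x = x - of_int \<lceil>x\<rceil> + 1"

lemma upper_frac_pos: "upper_frac x > 0"
  unfolding upper_frac_def by linarith

lemma upper_frac_le_1: "upper_frac x \<le> 1"
  unfolding upper_frac_def by linarith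

lemma first_overflow:
  fixes g :: "'a \<Rightarrow> real" and N :: nat
  assumes "finite I" "I \<noteq> {}" and pos: "\<And>i. i \<in> I \<Longrightarrow> 0 < g i" and less: "sum g I < 1"
    and "N > 0" and N: "\<And>i. i \<in> I \<Longrightarrow> real N * g i \<in> \<int>"
  obtains j :: nat where
    "(\<Sum>i\<in>I. upper_frac (real j * g i)) < 1"
    "(\<Sum>i\<in>I. upper_frac (real j * g i)) + sum g I \<ge> 1"
    "\<And>i. i \<in> I \<Longrightarrow> upper_frac (real j * g i) + g i \<le> 1"
proof -
  define t where "t = (\<lambda>(m::nat) i. upper_frac (real m * g i))"
  define P where "P = (\<lambda>m::nat. m > 0 \<and> sum (t m) I \<ge> 1)"
  \<comment> \<open>Integers have \<open>upper_frac\<close> 1 rather than 0, so the sum at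
    \<open>N\<close> is \<open>card I\<close> and an overflow does occur.\<close>
  have "t N i = 1" if "i \<in> I" for i
    using N[OF that] by (auto simp: t_def upper_frac_def elim: Ints_cases)
  hence "sum (t N) I = real (card I)" by simp
  moreover have "card I > 0" using assms by (simp add: card_gt_0_iff)
  ultimately have "P N" using \<open>N > 0\<close> by (simp add: P_def)
  define m where "m = (LEAST m. P m)"
  have m: "P m" unfolding m_def by (rule LeastI) (fact \<open>P N\<close>)
  have least: "\<not> P j" if "j < m" for j using that not_less_Least unfolding m_def by blast
  have g1: "g i < 1" if "i \<in> I" for i
    using member_le_sum[of i I g] that pos less assms(1) by (fastforce simp: less_imp_le)
  have "t 1 i = g i" if "i \<in> I" for i
    using pos[OF that] g1[OF that] by (simp add: t_def upper_frac_def ceiling_eq_iff)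
  hence "sum (t 1) I < 1" using less by simp
  hence "m \<noteq> 1" using m by (auto simp: P_def)
  then obtain j where j: "m = Suc j" "j > 0" using m by (cases m) (auto simp: P_def)
  have Tj: "sum (t j) I < 1" using least[of j] j by (auto simp: P_def)
  \<comment> \<open>Each wrap-around in the step from \<open>j\<close> to \<open>m\<close> costs \<open>1\<close>, more than the gain \<open>sum g I\<close>.\<close>
  define D where "D = (\<lambda>i. \<lceil>real m * g i\<rceil> - \<lceil>real j * g i\<rceil>)"
  have D0: "D i \<ge> 0" if "i \<in> I" for i
    unfolding D_def using pos[OF that] j by (simp add: ceiling_mono mult_right_mono)
  have tm: "t m i = t j i + g i - D i" for i
    by (simp add: t_def upper_frac_def D_def j algebra_simps)
  have Tm: "sum (t m) I = sum (t j) I + sum g I - of_int (sum D I)"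
    by (simp add: tm sum.distrib sum_subtractf)
  \<comment> \<open>\<open>sum (t j) I + sum g I\<close> is below 2, while
    \<open>sum (t m) I\<close> is at least 1.\<close>
  have "real_of_int (sum D I) < 1" using Tm Tj less m by (auto simp: P_def)
  moreover have "sum D I \<ge> 0" using D0 by (simp add: sum_nonneg)
  ultimately have DI: "sum D I = 0" by linarith
  hence D: "D i = 0" if "i \<in> I" for i
    using that D0 assms(1) by (simp add: sum_nonneg_eq_0_iff)
  show thesis
  proof
    show "(\<Sum>i\<in>I. upper_frac (real j * g i)) < 1"
      using Tj by (simp add: t_def)
    show "(\<Sum>i\<in>I. upper_frac (real j * g i)) + sum g I \<ge> 1"
      using Tm DI m by (simp add: t_def P_def)
    fix i assume "i \<in> I"
    hence "t j i + g i = t m i" using tm D by simp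
    also have "\<dots> \<le> 1" by (simp add: t_def upper_frac_le_1)
    finally show "upper_frac (real j * g i) + g i \<le> 1" by (simp add: t_def)
  qed
qed

section \<open>Choice of the weights\<close>

lemma exists_sum_between:
  fixes a :: "'a \<Rightarrow> int"
  assumes "finite I" "\<And>i. i \<in> I \<Longrightarrow> 0 \<le> a i" "0 \<le> k" "k \<le> sum a I"
  shows "\<exists>b. (\<forall>i\<in>I. 0 \<le> b i \<and> b i \<le> a i) \<and> sum b I = k"
  using assms
proof (induction I arbitrary: k rule: finite_induct)
  case empty
  thus ?case by simp
next
  case (insert x F)
  \<comment> \<open>Greedy choice: \<open>x\<close> takes as much of \<open>k\<close> as its bound
    allows, and the other bounds have room for the rest.\<close>
  define c where "c = min k (a x)"
  have "\<exists>b. (\<forall>i\<in>F. 0 \<le> b i \<and> b i \<le> a i) \<and> sum b F = k - c"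
    by (rule insert.IH) (use insert sum_nonneg[of F a] in \<open>auto simp: c_def\<close>)
  then obtain b where b: "\<forall>i\<in>F. 0 \<le> b i \<and> b i \<le> a i" "sum b F = k - c" by blast
  have "sum (b(x := c)) (insert x F) = k"
    using insert.hyps b(2) by (simp add: sum.insert) (smt (verit) fun_upd_other sum.cong)
  thus ?case using b insert.prems insert.hyps
    by (intro exI[of _ "b(x := c)"]) (auto simp: c_def)
qed

text \<open>Hypothesis \<open>nv\<close> keeps vertices out: if \<open>l\<close> were concentrated
  at one index, the bounds and the total would force \<open>\<mu> = l\<close>.\<close>

lemma even_weights_exist:
  fixes l :: "'n::finite \<Rightarrow> real" and N :: nat
  assumes n: "CARD('n) \<ge> 4" and l0: "\<And>i. 0 \<le> l i" and suml: "sum l UNIV = real CARD('n) - 2"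
    and "N > 0" and N: "\<And>i. real N * l i \<in> \<int>"
    and nv: "\<And>i. l i \<noteq> real CARD('n) - 2"
  obtains \<mu> :: "'n \<Rightarrow> real" and c :: int and b :: "'n \<Rightarrow> int" where
    "\<And>i. \<mu> i = of_int c * (2 * l i) + of_int (b i)" "\<And>i. 0 \<le> \<mu> i" "\<And>i. \<mu> i \<le> 2 * l i"
    "sum \<mu> UNIV = real CARD('n) - 2" "\<mu> \<noteq> l"
proof -
  define k :: int where "k = int CARD('n) - 2"
  have k: "real CARD('n) - 2 = of_int k" "k \<ge> 2" using n by (auto simp: k_def)
  define a where "a = (\<lambda>i. \<lfloor>2 * l i\<rfloor>)"
  have a0: "a i \<ge> 0" for i using l0 by (simp add: a_def)
  have al: "a i \<le> 2 * l i" "2 * l i < a i + 1" for i unfolding a_def by linarith+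
  have sum2l: "(\<Sum>i\<in>UNIV. 2 * l i) = 2 * of_int k" using suml k by (simp flip: sum_distrib_left)
  show thesis
  proof (cases "sum a UNIV \<ge> k")
    case True
    have "\<exists>b. (\<forall>i. 0 \<le> b i \<and> real_of_int (b i) \<le> 2 * l i) \<and> sum b UNIV = k \<and> (\<lambda>i. real_of_int (b i)) \<noteq> l"
    proof (cases "\<forall>i. l i \<in> \<int>")
      case False
      obtain b where b: "\<forall>i\<in>UNIV. 0 \<le> b i \<and> b i \<le> a i" "sum b UNIV = k"
        using exists_sum_between[of UNIV a k] a0 k True by auto
      have "real_of_int (b i) \<le> 2 * l i" for i using b(1) al[of i]
        by (meson UNIV_I of_int_le_iff order_trans)
      moreover have "(\<lambda>i. real_of_int (b i)) \<noteq> l" using False by auto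
      ultimately show ?thesis using b by auto
    next
      case True
      define m where "m = (\<lambda>i. \<lfloor>l i\<rfloor>)"
      have lm: "l i = of_int (m i)" for i using True by (simp add: m_def)
      have m0: "m i \<ge> 0" for i using l0 by (simp add: m_def)
      have "real_of_int (sum m UNIV) = of_int k" using suml k(1) by (simp flip: lm)
      hence summ: "sum m UNIV = k" by (simp only: of_int_eq_iff)
      have "\<exists>p. m p > 0"
      proof (rule ccontr)
        assume "\<nexists>p. m p > 0"
        hence "sum m UNIV \<le> 0" by (simp add: sum_nonpos not_less)
        thus False using summ k(2) by simp
      qed
      then obtain p where p: "m p > 0" ..
      have split: "sum m UNIV = m p + sum m (UNIV - {p})" by (rule sum.remove) auto
      have "m p \<noteq> k" using nv[of p] k lm by simp
      hence "sum m (UNIV - {p}) \<noteq> 0" using summ split by simp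
      then obtain q where q: "q \<noteq> p" "m q > 0"
        using sum.neutral[of "UNIV - {p}" m] m0 by (metis DiffE insertI1 order_less_le)
      \<comment> \<open>One unit moves from \<open>q\<close> to \<open>p\<close>; the bound
        \<open>m p + 1 \<le> 2 * m p\<close> holds because \<open>m p\<close> is at least 1.\<close>
      define b where "b = m(p := m p + 1, q := m q - 1)"
      have "b i = m i + (if i = p then 1 else 0) - (if i = q then 1 else 0)" for i
        using q by (simp add: b_def)
      hence "sum b UNIV = k" using summ by (simp add: sum.distrib sum_subtractf)
      moreover have "0 \<le> b i \<and> real_of_int (b i) \<le> 2 * l i" for i
        using p q m0[of i] by (auto simp: b_def lm)
      moreover have "real_of_int (b p) \<noteq> l p" using q by (simp add: b_def lm)
      ultimately show ?thesis by metis
    qed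
    then obtain b where b: "\<forall>i. 0 \<le> b i \<and> real_of_int (b i) \<le> 2 * l i" "sum b UNIV = k"
      "(\<lambda>i. real_of_int (b i)) \<noteq> l" by blast
    show thesis
      by (rule that[of "\<lambda>i. of_int (b i)" 0 b]) (use b k in \<open>auto simp flip: of_int_sum\<close>)
  next
    case False
    define g where "g = (\<lambda>i. a i + 1 - 2 * l i)"
    have gpos: "g i > 0" for i using al[of i] by (simp add: g_def)
    \<comment> \<open>The choice of \<open>k\<close> enters here: there are \<open>k + 2\<close>
      indices, so positivity of this sum leaves \<open>k - 1\<close> as the only value of
      \<open>sum a UNIV\<close> below \<open>k\<close>.\<close>
    have sumg: "sum g UNIV = of_int (sum a UNIV - k + 2)"
      using sum2l k(1) by (simp add: g_def sum.distrib sum_subtractf)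
    moreover have "sum g UNIV > 0" using gpos by (simp add: sum_pos)
    ultimately have "sum a UNIV - k + 2 > 0" by (simp only: of_int_0_less_iff)
    hence suma: "sum a UNIV = k - 1" using False by linarith
    have sumg1: "sum g UNIV = 1" using sumg suma by simp
    obtain p :: 'n where True by simp
    define I where "I = UNIV - {p}"
    have split: "sum f UNIV = f p + sum f I" for f :: "'n \<Rightarrow> real"
      unfolding I_def by (rule sum.remove) auto
    have "card I = CARD('n) - 1" by (simp add: I_def)
    hence "I \<noteq> {}" using n by auto
    have Ng: "real N * g i \<in> \<int>" for i
    proof -
      have "real N * g i = of_int (int N * (a i + 1)) - 2 * (real N * l i)"
        by (simp add: g_def algebra_simps)
      thus ?thesis using N[of i] by auto
    qed
    have "sum g I < 1" using split[of g] sumg1 gpos[of p] by simp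
    then obtain j where "(\<Sum>i\<in>I. upper_frac (real j * g i)) < 1"
      "(\<Sum>i\<in>I. upper_frac (real j * g i)) + sum g I \<ge> 1"
      "\<And>i. i \<in> I \<Longrightarrow> upper_frac (real j * g i) + g i \<le> 1"
      using first_overflow[of I g N] \<open>I \<noteq> {}\<close> gpos \<open>N > 0\<close> Ng by (metis finite)
    moreover define t where "t = (\<lambda>i. upper_frac (real j * g i))"
    ultimately have j: "sum t I < 1" "sum t I + sum g I \<ge> 1" "\<And>i. i \<in> I \<Longrightarrow> t i + g i \<le> 1"
      by simp_all
    \<comment> \<open>Index \<open>p\<close> receives whatever brings the total to 1.\<close>
    define s where "s = t(p := 1 - sum t I)"
    have sI: "sum s I = sum t I" by (rule sum.cong) (auto simp: s_def I_def)
    have tpos: "t i > 0" for i by (simp add: t_def upper_frac_pos)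
    have spos: "s i > 0" for i using tpos j(1) by (auto simp: s_def)
    \<comment> \<open>At \<open>p\<close> the left side is \<open>2 - sum t I - sum g I\<close>, so
      the overflow inequality bounds it by 1.\<close>
    have sg: "s i + g i \<le> 1" for i
      using j split[of g] sumg1 by (auto simp: s_def I_def)
    have sums: "sum s UNIV = 1" using split[of s] sI by (simp add: s_def)
    \<comment> \<open>The integers by which \<open>s\<close> differs from \<open>real j * g\<close>;
      the value at \<open>p\<close> comes from \<open>sum g I = 1 - g p\<close>.\<close>
    define h where "h = (\<lambda>i. if i = p then 1 - int j + (\<Sum>i\<in>I. \<lceil>real j * g i\<rceil> - 1) else 1 - \<lceil>real j * g i\<rceil>)"
    have sh: "s i = real j * g i + of_int (h i)" for i
    proof (cases "i = p")
      case True
      have "sum t I = real j * sum g I - of_int (\<Sum>i\<in>I. \<lceil>real j * g i\<rceil> - 1)"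
        by (simp add: t_def upper_frac_def sum_subtractf sum.distrib sum_distrib_left)
      moreover have "sum g I = 1 - g p" using split[of g] sumg1 by simp
      ultimately show ?thesis using True by (simp add: s_def h_def algebra_simps)
    qed (simp add: s_def h_def t_def upper_frac_def)
    define \<mu> where "\<mu> = (\<lambda>i. a i + s i)"
    show thesis
    \<comment> \<open>Substituting \<open>g i = a i + 1 - 2 * l i\<close> into
      \<open>a i + real j * g i + h i\<close> yields these coefficients.\<close>
    proof (rule that[of \<mu> "- int j" "\<lambda>i. a i + int j * (a i + 1) + h i"])
      fix i
      show "\<mu> i = of_int (- int j) * (2 * l i) + of_int (a i + int j * (a i + 1) + h i)"
        by (simp add: \<mu>_def sh g_def algebra_simps)
      show "0 \<le> \<mu> i" using a0[of i] spos[of i] by (simp add: \<mu>_def)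
      show "\<mu> i \<le> 2 * l i" using sg[of i] by (simp add: \<mu>_def g_def)
    next
      show "sum \<mu> UNIV = real CARD('n) - 2"
        using sums suma k by (simp add: \<mu>_def sum.distrib flip: of_int_sum)
      show "\<mu> \<noteq> l"
      proof
        assume "\<mu> = l"
        \<comment> \<open>From \<open>a i < l i\<close> and \<open>2 * l i < a i + 1\<close> follows
          \<open>a i < 1\<close>; yet the sum of \<open>a\<close> is \<open>k - 1\<close>, which is
          positive.\<close>
        have "a i = 0" for i
        proof -
          have "a i + s i = l i" using \<open>\<mu> = l\<close> by (auto simp: \<mu>_def)
          hence "real_of_int (a i) < 1" using spos[of i] gpos[of i] al[of i] by linarith
          thus ?thesis using a0[of i] by linarith
        qed
        thus False using suma k by simp
      qed
    qed
  qed
qed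


section \<open>Common denominators and simplex coordinates\<close>

lemma det_Ints:
  fixes A :: "real^'n^'n"
  assumes "\<And>i j. A $ i $ j \<in> \<int>"
  shows "det A \<in> \<int>"
  unfolding det_def by (intro Ints_sum Ints_mult Ints_prod assms) auto

text \<open>By Cramer's rule the determinant of \<open>A\<close> clears all denominators; its
  absolute value serves as \<open>N\<close>.\<close>

lemma integral_system_common_denominator:
  fixes A :: "real^'n^'n" and x :: "real^'n"
  assumes "det A \<noteq> 0" and A: "\<And>i j. A $ i $ j \<in> \<int>" and Ax: "\<And>i. (A *v x) $ i \<in> \<int>"
  obtains N :: nat where "N > 0" "\<And>i. real N * x $ i \<in> \<int>"
proof -
  obtain D :: int where D: "det A = of_int D" using det_Ints[OF A] by (auto elim: Ints_cases)
  have "of_int D * x $ i \<in> \<int>" for i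
  proof -
    define B where "B = (\<chi> r c. if c = i then (A *v x) $ r else A $ r $ c)"
    have "x $ i = det B / det A"
      using cramer[OF assms(1), of x "A *v x"] by (simp add: B_def vec_eq_iff)
    moreover have "det B \<in> \<int>" by (rule det_Ints) (use A Ax in \<open>auto simp: B_def\<close>)
    ultimately show ?thesis using assms(1) D by simp
  qed
  hence *: "of_int \<bar>D\<bar> * x $ i \<in> \<int>" for i
    by (cases "D \<ge> 0") auto
  show thesis
    by (rule that[of "nat \<bar>D\<bar>"]) (use * assms(1) D in \<open>auto\<close>)
qed

text \<open>Affine dimension one less than the number of indices leaves no room for repeated or
  dependent points.\<close>

lemma simplex_vertices_affine_independent:
  fixes u :: "'n::finite \<Rightarrow> 'a::euclidean_space"
  assumes "(int CARD('n) - 1) simplex (convex hull (range u))"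
  shows "inj u" "\<not> affine_dependent (range u)"
proof -
  have dim: "aff_dim (range u) = int CARD('n) - 1"
    using aff_dim_simplex[OF assms] by (simp add: aff_dim_convex_hull)
  moreover have "card (range u) \<le> CARD('n)" by (rule card_image_le) simp
  ultimately have card: "card (range u) = CARD('n)"
    using aff_dim_le_card[of "range u"] by simp
  thus "inj u" by (simp add: eq_card_imp_inj_on)
  show "\<not> affine_dependent (range u)"
    using dim card by (simp add: affine_independent_iff_card)
qed

text \<open>Applying \<open>f\<close> to a linear relation shows that its coefficients sum to 0,
  which makes it an affine relation.\<close>

lemma affine_independent_family_on_hyperplane:
  fixes u :: "'n::finite \<Rightarrow> 'a::euclidean_space"
  assumes "inj u" "\<not> affine_dependent (range u)"
    and "linear f" and f: "\<And>i. f (u i) = (r::real)" and "r \<noteq> 0"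
    and eq: "(\<Sum>i\<in>UNIV. c i *\<^sub>R u i) = 0"
  shows "c i = 0"
proof (rule ccontr)
  assume "c i \<noteq> 0"
  have "f (\<Sum>i\<in>UNIV. c i *\<^sub>R u i) = sum c UNIV * r"
    using \<open>linear f\<close> f by (simp add: linear_sum linear_cmul sum_distrib_right)
  hence "sum c UNIV = 0" using eq \<open>r \<noteq> 0\<close> \<open>linear f\<close> by (simp add: linear_0)
  moreover define U where "U = c \<circ> inv u"
  have U: "U (u i) = c i" for i using \<open>inj u\<close> by (simp add: U_def)
  ultimately have "sum U (range u) = 0" "(\<Sum>v\<in>range u. U v *\<^sub>R v) = 0"
    using \<open>inj u\<close> eq by (simp_all add: sum.reindex U)
  moreover have "U (u i) \<noteq> 0" using U \<open>c i \<noteq> 0\<close> by simp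
  ultimately have "affine_dependent (range u)"
    by (subst affine_dependent_explicit_finite) (auto intro!: exI[of _ U])
  thus False using assms by simp
qed

lemma scaled_convex_hull_range:
  fixes u :: "'n::finite \<Rightarrow> 'a::real_vector"
  assumes "inj u" "k > 0"
  shows "(\<lambda>x. k *\<^sub>R x) ` (convex hull (range u)) =
    {\<Sum>i\<in>UNIV. l i *\<^sub>R u i | l. (\<forall>i. 0 \<le> l i) \<and> sum l UNIV = k}" (is "?L = ?R")
proof (intro equalityI subsetI)
  fix x assume "x \<in> ?L"
  then obtain w where w: "\<forall>v\<in>range u. 0 \<le> w v" "sum w (range u) = 1"
    "x = k *\<^sub>R (\<Sum>v\<in>range u. w v *\<^sub>R v)"
    by (auto simp: convex_hull_finite)
  show "x \<in> ?R"
    using w assms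
    by (intro CollectI exI[of _ "\<lambda>i. k * w (u i)"])
       (auto simp: sum.reindex scaleR_sum_right simp flip: sum_distrib_left)
next
  fix x assume "x \<in> ?R"
  then obtain l where l: "\<forall>i. 0 \<le> l i" "sum l UNIV = k" "x = (\<Sum>i\<in>UNIV. l i *\<^sub>R u i)"
    by blast
  have "(\<Sum>i\<in>UNIV. (l i / k) *\<^sub>R u i) \<in> convex hull (range u)"
    using l assms by (intro convex_sum) (auto simp: hull_inc simp flip: sum_divide_distrib)
  moreover have "x = k *\<^sub>R (\<Sum>i\<in>UNIV. (l i / k) *\<^sub>R u i)"
    using l assms by (simp add: scaleR_sum_right)
  ultimately show "x \<in> ?L" by blast
qed

section \<open>Closure properties of the lattices\<close>

lemma even_lattice_iff: "x \<in> even_lattice \<longleftrightarrow> (1/2) *\<^sub>R x \<in> int_lattice"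
proof -
  have "(\<exists>k::int. r = 2 * of_int k) \<longleftrightarrow> r / 2 \<in> \<int>" for r :: real
    by (auto elim!: Ints_cases simp: field_simps)
  thus ?thesis by (simp add: even_lattice_def int_lattice_def)
qed

lemma int_lattice_add: "x \<in> int_lattice \<Longrightarrow> y \<in> int_lattice \<Longrightarrow> x + y \<in> int_lattice"
  by (simp add: int_lattice_def)

lemma int_lattice_scaleR_int: "x \<in> int_lattice \<Longrightarrow> of_int c *\<^sub>R x \<in> int_lattice"
  by (simp add: int_lattice_def)

lemma even_lattice_add: "x \<in> even_lattice \<Longrightarrow> y \<in> even_lattice \<Longrightarrow> x + y \<in> even_lattice"
  by (simp add: even_lattice_iff int_lattice_add scaleR_add_right)

lemma even_lattice_scaleR_int: "x \<in> even_lattice \<Longrightarrow> of_int c *\<^sub>R x \<in> even_lattice"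
  using int_lattice_scaleR_int[of "(1/2) *\<^sub>R x" c] by (simp add: even_lattice_iff mult.commute)

lemma even_lattice_sum:
  "finite I \<Longrightarrow> (\<And>i. i \<in> I \<Longrightarrow> f i \<in> even_lattice) \<Longrightarrow> sum f I \<in> even_lattice"
  by (induction I rule: finite_induct) (auto simp: even_lattice_add, simp add: even_lattice_def)

lemma even_lattice_subset_int_lattice: "even_lattice \<subseteq> int_lattice"
  unfolding even_lattice_def int_lattice_def by auto (metis Ints_mult Ints_numeral Ints_of_int)

section \<open>Midpoints in the scaled simplex\<close>

theorem theorem3p6:
  fixes u :: "'n::finite \<Rightarrow> real ^ 'n" and d :: nat
  assumes "CARD('n) \<ge> 4"
    and "d \<ge> 1"
    and "\<And>i. u i \<in> even_lattice"
    and "\<And>i j. u i $ j \<ge> 0"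
    and "\<And>i. (\<Sum>j\<in>UNIV. u i $ j) = 2 * real d"
    and "(int CARD('n) - 1) simplex (convex hull (range u))"
  shows "mediated (\<lambda>i. (real CARD('n) - 2) *\<^sub>R u i)
           (((\<lambda>x. (real CARD('n) - 2) *\<^sub>R x) ` (convex hull (range u))) \<inter> int_lattice)"
proof -
  define k where "k = real CARD('n) - 2"
  have kint: "k = of_int (int CARD('n) - 2)" by (simp add: k_def)
  have "k > 0" using assms(1) by (simp add: k_def)
  note ind = simplex_vertices_affine_independent[OF assms(6)]
  define F where "F = (\<lambda>l. \<Sum>i\<in>UNIV. l i *\<^sub>R u i)"
  have Fadd: "F (\<lambda>i. l i + m i) = F l + F m" and Fdiff: "F (\<lambda>i. l i - m i) = F l - F m"
    and Fscale: "F (\<lambda>i. r * l i) = r *\<^sub>R F l" for l m r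
    by (simp_all add: F_def scaleR_add_left scaleR_diff_left sum.distrib sum_subtractf scaleR_sum_right)
  have lin: "linear (\<lambda>x::real^'n. \<Sum>j\<in>UNIV. x $ j)"
    by (rule linearI) (simp_all add: sum.distrib sum_distrib_left)
  have Fzero: "c i = 0" if "F c = 0" for c i
    using affine_independent_family_on_hyperplane[OF ind lin assms(5)] assms(2) that
    by (simp add: F_def)
  have Finj: "l = m" if "F l = F m" for l m
    using Fzero[of "\<lambda>i. l i - m i"] that by (auto simp: Fdiff)
  \<comment> \<open>With the vertices as columns, the weights of a lattice point solve an integral
    linear system.\<close>
  define A :: "real^'n^'n" where "A = (\<chi> i j. u j $ i)"
  have AF: "A *v x = F (\<lambda>i. x $ i)" for x
    by (simp add: A_def F_def matrix_vector_mult_def vec_eq_iff mult.commute)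
  have uint: "u i \<in> int_lattice" for i using assms(3) even_lattice_subset_int_lattice by blast
  have "inj ((*v) A)"
    by (rule injI) (metis AF Finj vec_eq_iff)
  hence detA: "det A \<noteq> 0" using det_nz_iff_inj[of "(*v) A"] by simp
  define S where "S = (\<lambda>x. k *\<^sub>R x) ` (convex hull (range u))"
  have S: "S = {F l | l. (\<forall>i. 0 \<le> l i) \<and> sum l UNIV = k}"
    unfolding S_def F_def by (rule scaled_convex_hull_range) (use ind \<open>k > 0\<close> in auto)
  have mid: "\<exists>z1 \<in> S \<inter> int_lattice \<inter> even_lattice. \<exists>z2 \<in> S \<inter> int_lattice \<inter> even_lattice.
      z1 \<noteq> z2 \<and> y = (1/2) *\<^sub>R (z1 + z2)"
    if y: "y \<in> S" "y \<in> int_lattice" "\<And>i. y \<noteq> k *\<^sub>R u i" for y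
  proof -
    obtain l where l: "\<And>i. 0 \<le> l i" "sum l UNIV = k" "y = F l" using y(1) S by blast
    obtain N :: nat where N: "N > 0" "\<And>i. real N * l i \<in> \<int>"
    proof (rule integral_system_common_denominator[OF detA, of "\<chi> i. l i"])
      show "A $ i $ j \<in> \<int>" for i j using uint by (simp add: A_def int_lattice_def)
      show "(A *v (\<chi> i. l i)) $ i \<in> \<int>" for i
        using y(2) l(3) by (simp add: AF int_lattice_def)
    qed auto
    have nv: "l i \<noteq> k" for i
    proof
      assume "l i = k"
      hence "sum l (UNIV - {i}) = 0" using l(2) sum.remove[of UNIV i l] by simp
      hence "l j = 0" if "j \<noteq> i" for j
        using that l(1) by (subst (asm) sum_nonneg_eq_0_iff) auto
      hence "F l = (\<Sum>j\<in>UNIV. if j = i then k *\<^sub>R u i else 0)"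
        unfolding F_def using \<open>l i = k\<close> by (intro sum.cong) auto
      thus False using y(3)[of i] l(3) by simp
    qed
    obtain \<mu> c b where \<mu>: "\<And>i. \<mu> i = of_int c * (2 * l i) + of_int (b i)" "\<And>i. 0 \<le> \<mu> i"
      "\<And>i. \<mu> i \<le> 2 * l i" "sum \<mu> UNIV = k" "\<mu> \<noteq> l"
      by (rule even_weights_exist[OF assms(1) l(1) _ N, folded k_def, OF l(2) nv]) blast
    have "2 *\<^sub>R y \<in> even_lattice" using y(2) by (simp add: even_lattice_iff)
    have "F (\<lambda>i. of_int (b i)) \<in> even_lattice"
      unfolding F_def by (intro even_lattice_sum even_lattice_scaleR_int assms(3)) simp
    moreover have "F \<mu> = of_int c *\<^sub>R (2 *\<^sub>R y) + F (\<lambda>i. of_int (b i))"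
      unfolding \<mu>(1) Fadd Fscale l(3) ..
    ultimately have z1: "F \<mu> \<in> even_lattice"
      using \<open>2 *\<^sub>R y \<in> even_lattice\<close> by (simp only: even_lattice_add even_lattice_scaleR_int)
    have Fz2: "F (\<lambda>i. 2 * l i - \<mu> i) = 2 *\<^sub>R y + of_int (-1) *\<^sub>R F \<mu>"
      by (simp add: Fdiff Fscale l(3))
    hence z2: "F (\<lambda>i. 2 * l i - \<mu> i) \<in> even_lattice"
      using \<open>2 *\<^sub>R y \<in> even_lattice\<close> z1 by (simp only: even_lattice_add even_lattice_scaleR_int)
    have "F \<mu> \<in> S" using \<mu> S by blast
    moreover have "F (\<lambda>i. 2 * l i - \<mu> i) \<in> S"
      unfolding S using \<mu> l(2)
      by (intro CollectI exI[of _ "\<lambda>i. 2 * l i - \<mu> i"])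
         (auto simp: sum_subtractf simp flip: sum_distrib_left)
    moreover have "F \<mu> \<noteq> F (\<lambda>i. 2 * l i - \<mu> i)"
    proof
      assume "F \<mu> = F (\<lambda>i. 2 * l i - \<mu> i)"
      hence "\<mu> = (\<lambda>i. 2 * l i - \<mu> i)" by (rule Finj)
      hence "\<mu> i = 2 * l i - \<mu> i" for i by (rule fun_cong)
      hence "\<mu> i = l i" for i by (simp add: field_simps)
      thus False using \<mu>(5) by auto
    qed
    moreover have "y = (1/2) *\<^sub>R (F \<mu> + F (\<lambda>i. 2 * l i - \<mu> i))"
      by (simp add: Fz2)
    ultimately show ?thesis using z1 z2 even_lattice_subset_int_lattice by blast
  qed
  have "range (\<lambda>i. k *\<^sub>R u i) \<subseteq> S" by (auto simp: S_def hull_inc)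
  moreover have "range (\<lambda>i. k *\<^sub>R u i) \<subseteq> int_lattice"
    using uint int_lattice_scaleR_int kint by fastforce
  moreover have "S = convex hull (range (\<lambda>i. k *\<^sub>R u i))"
    unfolding S_def convex_hull_scaling[symmetric] by (simp add: image_image)
  ultimately have "mediated (\<lambda>i. k *\<^sub>R u i) (S \<inter> int_lattice)"
    unfolding mediated_def using mid by blast
  thus ?thesis by (simp add: S_def k_def)
qed

end
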